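(* For every integer $n \ge 1$, we have \[ \nu_3 \left( \sum_{r = 0}^n \binom{n}{r}^3 2^r \right) = \begin{cases} s_3 \left( \dfrac{n - 1}{2} \right) + 1 &\text{if } n \text{ is odd}, \\[1ex] s_3 \left( \dfrac{n}{2} \right) &\text{if } n \text{ is even}. \end{cases} \]
   Context: For a nonzero integer $a$, $\nu_3(a)$ denotes the $3$-adic valuation of $a$, i.e. the largest integer $e \ge 0$ such that $3^e$ divides $a$. For a nonnegative integer $k$, $s_3(k)$ denotes the sum of the digits of $k$ written in base $3$ (so $s_3(0) = 0$). *)

theory Defs
  imports "HOL-Computational_Algebra.Computational_Algebra"
begin

(* Least significant digit first, without leading zeros; 0 has no digits. *)
fun digits3 :: "nat \<Rightarrow> nat list" where
  "digits3 k = (if k = 0 then [] else (k mod 3) # digits3 (k div 3))"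

declare digits3.simps [simp del]

definition s3 :: "nat \<Rightarrow> nat" where
  "s3 k = sum_list (digits3 k)"

lemma digits3_less: "d \<in> set (digits3 k) \<Longrightarrow> d < 3"
proof (induction k rule: digits3.induct)
  case (1 k)
  then show ?case
    by (subst (asm) (2) digits3.simps) (auto split: if_splits)
qed

lemma horner_sum_digits3: "horner_sum (\<lambda>d. d) 3 (digits3 k) = k"
proof (induction k rule: digits3.induct)
  case (1 k)
  then show ?case
    by (subst digits3.simps) simp
qed

end

theory Submission
  imports Defs
begin

text \<open>
  MacMahon's identity rewrites \<open>\<Sum>r. (n choose r)^3 x^r y^(n-r)\<close> as
  \<open>\<Sum>j. (n+j choose 3j) (3j)!/(j!)^3 (xy)^j (x+y)^(n-2j)\<close>, with \<open>2j \<le> n\<close>. At \<open>x = 2\<close>, \<open>y = 1\<close> the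
  factor \<open>x + y = 3\<close> makes the sum easy to analyse 3-adically: by Legendre's formula
  \<open>(3j)!/(j!)^3\<close> has valuation \<open>s3 j\<close>, so the \<open>j\<close>-th term has valuation at least
  \<open>s3 j + n - 2j\<close>. Since \<open>s3 m \<le> s3 j + (m - j)\<close>, the term \<open>j = m = n div 2\<close> strictly
  dominates, and its coefficient \<open>n+m choose 3m\<close> is \<open>1\<close> or \<open>3m + 1\<close>.
\<close>

section \<open>Binomial identities up to Nanjundiah's\<close>

lemma choose_mult_choose_commute:
  "k \<le> m \<Longrightarrow> (n choose m) * (m choose k) = (n choose k) * ((n - k) choose (m - k))"
  by (cases "m \<le> n") (auto simp: choose_mult binomial_eq_0)

text \<open>Trinomial revision frees \<open>n choose i\<close> from the summation index, and what
  remains is a Vandermonde convolution. This is the inner sum over \<open>k\<close> in the next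
  lemma.\<close>

lemma sum_choose_mult_choose_choose:
  assumes "i \<le> m"
  shows "(\<Sum>k\<le>m. (m choose k) * (n choose k) * (k choose i)) = (n choose i) * ((m + n - i) choose n)"
proof (cases "i \<le> n")
  case True
  have "(\<Sum>k\<le>m. (m choose k) * (n choose k) * (k choose i)) =
      (\<Sum>k=i..m. (n choose i) * (((n - i) choose (k - i)) * (m choose (m - k))))"
  proof (rule sum.mono_neutral_cong_right)
    fix k assume k: "k \<in> {i..m}"
    then have 1: "(m choose k) = (m choose (m - k))"
      by (intro binomial_symmetric) simp
    have 2: "(n choose k) * (k choose i) = (n choose i) * ((n - i) choose (k - i))"
      using k by (intro choose_mult_choose_commute) auto
    show "(m choose k) * (n choose k) * (k choose i) =
        (n choose i) * (((n - i) choose (k - i)) * (m choose (m - k)))"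
      unfolding 1[symmetric] mult.assoc 2 by (rule mult.left_commute[THEN trans]) (simp only: mult.commute)
  qed auto
  also have "\<dots> = (n choose i) * (\<Sum>k=i..m. ((n - i) choose (k - i)) * (m choose (m - k)))"
    by (simp add: sum_distrib_left)
  also have "(\<Sum>k=i..m. ((n - i) choose (k - i)) * (m choose (m - k))) =
      (\<Sum>l\<le>m - i. ((n - i) choose l) * (m choose (m - i - l)))"
    by (rule sum.reindex_bij_witness[of _ "\<lambda>l. l + i" "\<lambda>k. k - i"]) (use assms in auto)
  also have "\<dots> = (n - i + m) choose (m - i)"
    by (rule vandermonde)
  also have "\<dots> = (m + n - i) choose n"
    using assms True by (subst binomial_symmetric) (auto simp: algebra_simps)
  finally show ?thesis .
next
  case False
  have "(n choose k) * (k choose i) = 0" for k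
    using False by (cases "k < i") (simp_all add: binomial_eq_0)
  with False show ?thesis
    by (simp add: mult.assoc binomial_eq_0 del: mult_eq_0_iff)
qed

text \<open>
  Nanjundiah's identity: expand \<open>x + k choose m + n\<close> by Vandermonde, then sum over \<open>k\<close> first.
\<close>
lemma sum_choose_mult_choose:
  assumes "n \<le> x"
  shows "(\<Sum>k\<le>m. (m choose k) * (n choose k) * ((x + k) choose (m + n))) = (x choose m) * (x choose n)"
proof -
  have "(x + k) choose (m + n) = (\<Sum>i\<le>m. (k choose i) * (x choose (m + n - i)))" if "k \<le> m" for k
  proof -
    have "(x + k) choose (m + n) = (\<Sum>i\<le>m + n. (k choose i) * (x choose (m + n - i)))"
      by (simp add: vandermonde add.commute)
    \<comment> \<open>Terms with \<open>i > m\<close> vanish because \<open>k \<le> m < i\<close>; a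
      bound independent of \<open>k\<close> lets the two sums be swapped.\<close>
    also have "\<dots> = (\<Sum>i\<le>m. (k choose i) * (x choose (m + n - i)))"
      using that by (intro sum.mono_neutral_right) auto
    finally show ?thesis .
  qed
  then have "(\<Sum>k\<le>m. (m choose k) * (n choose k) * ((x + k) choose (m + n))) =
      (\<Sum>k\<le>m. \<Sum>i\<le>m. (x choose (m + n - i)) * ((m choose k) * (n choose k) * (k choose i)))"
    by (intro sum.cong refl) (simp add: sum_distrib_left mult_ac)
  also have "\<dots> = (\<Sum>i\<le>m. (x choose (m + n - i)) * (\<Sum>k\<le>m. (m choose k) * (n choose k) * (k choose i)))"
    by (subst sum.swap) (simp add: sum_distrib_left)
  also have "\<dots> = (\<Sum>i\<le>m. (x choose n) * ((n choose i) * ((x - n) choose (m - i))))"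
  proof (intro sum.cong refl)
    fix i assume "i \<in> {..m}"
    then have i: "i \<le> m" by simp
    \<comment> \<open>Trinomial revision again: \<open>x choose n\<close> comes out of the sum over
      \<open>i\<close>, leaving a second Vandermonde convolution.\<close>
    have "(x choose (m + n - i)) * ((m + n - i) choose n) = (x choose n) * ((x - n) choose (m - i))"
      using i choose_mult_choose_commute[of n "m + n - i" x] by simp
    then show "(x choose (m + n - i)) * (\<Sum>k\<le>m. (m choose k) * (n choose k) * (k choose i)) =
        (x choose n) * ((n choose i) * ((x - n) choose (m - i)))"
      unfolding sum_choose_mult_choose_choose[OF i] by (metis mult.assoc mult.commute)
  qed
  also have "\<dots> = (x choose n) * (\<Sum>i\<le>m. (n choose i) * ((x - n) choose (m - i)))"
    by (simp add: sum_distrib_left)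
  also have "(\<Sum>i\<le>m. (n choose i) * ((x - n) choose (m - i))) = x choose m"
    using assms by (simp add: vandermonde)
  finally show ?thesis by simp
qed

text \<open>Both sides are the multinomial coefficient
  \<open>(r+s+j)! / (j!^3 (r-j)! (s-j)!)\<close>. The right-hand form confines \<open>r\<close> to
  the last factor once \<open>r + s\<close> is fixed.\<close>

lemma choose_quadruple_product:
  assumes "j \<le> r" "j \<le> s"
  shows "((r + s) choose r) * ((r choose j) * (s choose j) * ((r + s + j) choose (r + s))) =
    ((r + s + j) choose (3 * j)) * ((3 * j) choose j) * ((2 * j) choose j) * ((r + s - 2 * j) choose (r - j))"
    (is "?L = ?R")
proof -
  obtain a b where ab: "r = a + j" "s = b + j"
    using assms by (metis le_add_diff_inverse2)
  have d: "r + s + j - 3 * j = a + b" "r + s - 2 * j = a + b" "3 * j - j = 2 * j" "2 * j - j = j"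
    "r - j = a" "s - j = b" "r + s - r = s" "a + b - a = b" "r + s + j - (r + s) = j"
    using ab by auto
  have le: "r \<le> r + s" "r + s \<le> r + s + j" "3 * j \<le> r + s + j" "j \<le> 3 * j" "j \<le> 2 * j" "a \<le> a + b"
    using assms by auto
  \<comment> \<open>The variables stand for factorials: \<open>p\<close>, \<open>q\<close>,
    \<open>u\<close>, \<open>z\<close> of \<open>r+s\<close>, \<open>r\<close>, \<open>s\<close>,
    \<open>r+s+j\<close>; \<open>v\<close>, \<open>x\<close>, \<open>f\<close> of \<open>3j\<close>,
    \<open>2j\<close>, \<open>j\<close>; \<open>w\<close>, \<open>g\<close>, \<open>h\<close> of
    \<open>a+b\<close>, \<open>a\<close>, \<open>b\<close>.\<close>
  have cancel: "p / (q * u) * (q / (f * g) * (u / (f * h)) * (z / (p * f))) =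
      z / (v * w) * (v / (f * x)) * (x / (f * f)) * (w / (g * h))"
    if "p \<noteq> 0" "q \<noteq> 0" "u \<noteq> 0" "v \<noteq> 0" "w \<noteq> 0" "x \<noteq> 0" for p q u v w x f g h z :: real
    using that by (simp add: field_simps)
  have "real ?L = real ?R"
    unfolding of_nat_mult d binomial_fact[OF assms(1)] binomial_fact[OF assms(2)]
      le[THEN binomial_fact] by (rule cancel) simp_all
  then show ?thesis
    by (simp only: of_nat_eq_iff)
qed

section \<open>Ternary digit sums and 3-adic valuations\<close>

text \<open>The valuation of \<open>k + 1\<close> counts the trailing digits 2 of \<open>k\<close>.
  The carry turns each of them into 0, and the next digit grows by 1.\<close>

lemma s3_Suc: "s3 (Suc k) + 2 * multiplicity 3 (int (Suc k)) = s3 k + 1"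
proof (induction k rule: less_induct)
  case (less k)
  have step: "s3 m = m mod 3 + s3 (m div 3)" for m
    by (cases "m = 0") (simp_all add: s3_def digits3.simps[of m])
  show ?case
  proof (cases "Suc k mod 3 = 0")
    case True
    define q where "q = k div 3"
    have k: "k = 3 * q + 2" using True unfolding q_def by presburger
    have "multiplicity 3 (3 * int (Suc q)) = Suc (multiplicity 3 (int (Suc q)))"
      by (rule multiplicity_times_same) auto
    moreover have "int (Suc k) = 3 * int (Suc q)" using k by simp
    moreover have "Suc k mod 3 = 0" "Suc k div 3 = Suc q" "k mod 3 = 2" "k div 3 = q"
      using k by presburger+
    ultimately show ?thesis
      using less.IH[of q] k step[of k] step[of "Suc k"] by (simp del: of_nat_Suc)
  next
    case False
    have "multiplicity 3 (int (Suc k)) = 0"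
      using False by (intro not_dvd_imp_multiplicity_0) presburger
    moreover have "Suc k mod 3 = Suc (k mod 3)" "Suc k div 3 = k div 3"
      using False by presburger+
    ultimately show ?thesis
      using step[of k] step[of "Suc k"] by simp
  qed
qed

lemma s3_triple: "s3 (3 * k) = s3 k"
  by (cases "k = 0") (simp_all add: s3_def digits3.simps[of "3 * k"])

lemma s3_0: "s3 0 = 0"
  by (simp add: s3_def digits3.simps)

lemma s3_add_le: "s3 (k + i) \<le> s3 k + i"
proof (induction i)
  case (Suc i)
  then show ?case using s3_Suc[of "k + i"] by simp
qed simp

text \<open>Legendre's formula at the prime 3, written without subtraction or division;
  \<open>s3_Suc\<close> telescopes over the factors of \<open>n!\<close>.\<close>

lemma multiplicity_3_fact: "2 * multiplicity 3 (fact n :: int) + s3 n = n"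
proof (induction n)
  case (Suc n)
  have "multiplicity 3 (fact (Suc n) :: int) = multiplicity 3 (int (Suc n)) + multiplicity 3 (fact n :: int)"
    unfolding fact_Suc by (rule prime_elem_multiplicity_mult_distrib) (auto simp del: of_nat_Suc)
  then show ?case using Suc s3_Suc[of n] by simp
qed (simp add: s3_0)

text \<open>The product is \<open>(3j)!/(j!)^3\<close>. As \<open>s3 (3j) = s3 j\<close>, Legendre's
  formula gives twice its valuation as \<open>(3j - s3 j) - 3(j - s3 j) = 2 s3 j\<close>.\<close>

lemma multiplicity_3_trinomial:
  "multiplicity 3 (int (((3 * j) choose j) * ((2 * j) choose j))) = s3 j"
proof -
  let ?c = "((3 * j) choose j) * ((2 * j) choose j)"
  have 1: "fact j * fact (3 * j - j) * ((3 * j) choose j) = fact (3 * j)"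
    by (rule binomial_fact_lemma) simp
  have 2: "fact j * fact (2 * j - j) * ((2 * j) choose j) = fact (2 * j)"
    by (rule binomial_fact_lemma) simp
  have j: "3 * j - j = 2 * j" "2 * j - j = j" by simp_all
  have "fact (3 * j) = fact j ^ 3 * ?c"
    unfolding 1[symmetric] j 2[symmetric] by (simp add: power3_eq_cube)
  then have "(fact (3 * j) :: int) = fact j ^ 3 * int ?c"
    by (metis of_nat_fact of_nat_mult of_nat_power)
  then have "multiplicity 3 (fact (3 * j) :: int) = 3 * multiplicity 3 (fact j :: int) + multiplicity 3 (int ?c)"
    by (simp add: prime_elem_multiplicity_mult_distrib prime_elem_multiplicity_power_distrib)
  then show ?thesis
    using multiplicity_3_fact[of j] multiplicity_3_fact[of "3 * j"] s3_triple[of j] by simp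
qed

section \<open>MacMahon's identity\<close>

text \<open>Nanjundiah's identity with \<open>x = n\<close> and lower indices \<open>r\<close>,
  \<open>n - r\<close>, multiplied by \<open>n choose r\<close>. The conditional makes the range of
  \<open>j\<close> independent of \<open>r\<close>, ready for swapping sums.\<close>

lemma choose_cubed:
  assumes "r \<le> n"
  shows "(n choose r) ^ 3 = (\<Sum>j\<le>n div 2. ((n + j) choose (3 * j)) * ((3 * j) choose j) * ((2 * j) choose j) *
    (if j \<le> r \<and> r + j \<le> n then (n - 2 * j) choose (r - j) else 0))"
    (is "_ = (\<Sum>j\<le>_. ?a j * ?b j)")
proof -
  define s where "s = n - r"
  have n: "n = r + s" using assms by (simp add: s_def)
  have "(n choose r) ^ 3 = (n choose r) * ((n choose r) * (n choose s))"
    unfolding n power3_eq_cube by (simp add: binomial_symmetric[of s "r + s"])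
  also have "(n choose r) * (n choose s) = (\<Sum>j\<le>r. (r choose j) * (s choose j) * ((n + j) choose n))"
    unfolding n by (rule sum_choose_mult_choose[symmetric]) simp
  also have "(n choose r) * \<dots> =
      (\<Sum>j\<le>r. (n choose r) * ((r choose j) * (s choose j) * ((n + j) choose n)))"
    by (rule sum_distrib_left)
  also have "\<dots> = (\<Sum>j\<in>{..min r s}. ?a j * ?b j)"
  proof (rule sum.mono_neutral_cong_right)
    fix j assume "j \<in> {..min r s}"
    then have j: "j \<le> r" "j \<le> s" by auto
    then show "(n choose r) * ((r choose j) * (s choose j) * ((n + j) choose n)) = ?a j * ?b j"
      unfolding n choose_quadruple_product[OF j] by simp
  qed auto
  \<comment> \<open>Here \<open>min r s \<le> n div 2\<close>, and the conditional kills the added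
    terms.\<close>
  also have "\<dots> = (\<Sum>j\<le>n div 2. ?a j * ?b j)"
    by (rule sum.mono_neutral_left) (use n in auto)
  finally show ?thesis .
qed

lemma MacMahon_cubes:
  fixes x y :: "'a::comm_semiring_1"
  shows "(\<Sum>r\<le>n. of_nat (n choose r) ^ 3 * x ^ r * y ^ (n - r)) =
    (\<Sum>j\<le>n div 2. of_nat (((n + j) choose (3 * j)) * ((3 * j) choose j) * ((2 * j) choose j)) *
      (x * y) ^ j * (x + y) ^ (n - 2 * j))"
proof -
  let ?a = "\<lambda>j. ((n + j) choose (3 * j)) * ((3 * j) choose j) * ((2 * j) choose j)"
  let ?b = "\<lambda>r j. if j \<le> r \<and> r + j \<le> n then (n - 2 * j) choose (r - j) else 0"
  have "(\<Sum>r\<le>n. of_nat (n choose r) ^ 3 * x ^ r * y ^ (n - r)) =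
      (\<Sum>r\<le>n. \<Sum>j\<le>n div 2. of_nat (?a j) * (of_nat (?b r j) * x ^ r * y ^ (n - r)))"
  proof (intro sum.cong refl)
    fix r assume "r \<in> {..n}"
    then have "(n choose r) ^ 3 = (\<Sum>j\<le>n div 2. ?a j * ?b r j)"
      by (intro choose_cubed) simp
    then have "of_nat (n choose r) ^ 3 = (of_nat (\<Sum>j\<le>n div 2. ?a j * ?b r j) :: 'a)"
      by (simp only: of_nat_power[symmetric])
    then show "of_nat (n choose r) ^ 3 * x ^ r * y ^ (n - r) =
        (\<Sum>j\<le>n div 2. of_nat (?a j) * (of_nat (?b r j) * x ^ r * y ^ (n - r)))"
      by (simp only: of_nat_sum of_nat_mult sum_distrib_right mult.assoc)
  qed
  also have "\<dots> = (\<Sum>j\<le>n div 2. of_nat (?a j) * (\<Sum>r\<le>n. of_nat (?b r j) * x ^ r * y ^ (n - r)))"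
    by (subst sum.swap) (simp only: sum_distrib_left)
  also have "\<dots> = (\<Sum>j\<le>n div 2. of_nat (?a j) * (x * y) ^ j * (x + y) ^ (n - 2 * j))"
  proof (intro sum.cong refl)
    fix j assume "j \<in> {..n div 2}"
    then have j: "2 * j \<le> n" by auto
    have "(\<Sum>r\<le>n. of_nat (?b r j) * x ^ r * y ^ (n - r)) =
        (\<Sum>r=j..n - j. of_nat ((n - 2 * j) choose (r - j)) * x ^ r * y ^ (n - r))"
      by (rule sum.mono_neutral_cong_right) auto
    \<comment> \<open>Shifting by \<open>j\<close> at both ends of the range splits off
      \<open>(x * y) ^ j\<close> and leaves the binomial expansion of
      \<open>(x + y) ^ (n - 2 * j)\<close>.\<close>
    also have "\<dots> = (\<Sum>k\<le>n - 2 * j. of_nat ((n - 2 * j) choose k) * x ^ (k + j) * y ^ (n - 2 * j - k + j))"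
      by (rule sum.reindex_bij_witness[of _ "\<lambda>k. k + j" "\<lambda>r. r - j"]) (use j in auto)
    also have "\<dots> = (x * y) ^ j * (x + y) ^ (n - 2 * j)"
      unfolding binomial_ring by (simp add: sum_distrib_left power_add power_mult_distrib mult_ac)
    finally show "of_nat (?a j) * (\<Sum>r\<le>n. of_nat (?b r j) * x ^ r * y ^ (n - r)) =
        of_nat (?a j) * (x * y) ^ j * (x + y) ^ (n - 2 * j)"
      by (simp only: mult.assoc)
  qed
  finally show ?thesis .
qed

section \<open>The dominant term of the sum\<close>

theorem theorem1:
  fixes n :: nat
  assumes "n \<ge> 1"
  shows "multiplicity 3 (\<Sum>r = 0..n. int (n choose r) ^ 3 * 2 ^ r) =
    (if odd n then s3 ((n - 1) div 2) + 1 else s3 (n div 2))"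
proof -
  define m where "m = n div 2"
  define c where "c = (\<lambda>j. int (((3 * j) choose j) * ((2 * j) choose j)))"
  define t where "t = (\<lambda>j. int ((n + j) choose (3 * j)) * c j * 2 ^ j * 3 ^ (n - 2 * j))"
  \<comment> \<open>The claimed valuation; \<open>n mod 2\<close> is the exponent
    \<open>n - 2 * m\<close> of 3 left in the term \<open>t m\<close>.\<close>
  define v where "v = s3 m + n mod 2"
  have "(\<Sum>r = 0..n. int (n choose r) ^ 3 * 2 ^ r) = (\<Sum>j\<le>m. t j)"
    using MacMahon_cubes[of n "2::int" 1]
    by (simp add: t_def c_def m_def atMost_atLeast0 mult.assoc)
  also have "\<dots> = t m + (\<Sum>j<m. t j)"
    by (simp add: lessThan_Suc_atMost[symmetric])
  finally have sum: "(\<Sum>r = 0..n. int (n choose r) ^ 3 * 2 ^ r) = t m + (\<Sum>j<m. t j)" .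
  have n: "n = 2 * m + n mod 2"
    by (simp add: m_def)
  have c0: "c m \<noteq> 0"
    by (simp add: c_def)
  have c: "multiplicity 3 (c j) = s3 j" for j
    unfolding c_def by (rule multiplicity_3_trinomial)
  have lead: "\<not> 3 dvd int ((n + m) choose (3 * m))"
  proof (cases "n mod 2 = 0")
    case True
    then have "n + m = 3 * m" using n by linarith
    then show ?thesis by simp
  next
    case False
    then have "n + m = Suc (3 * m)" using n by linarith
    then have "int ((n + m) choose (3 * m)) = 3 * int m + 1" by simp
    then show ?thesis by presburger
  qed
  have "\<not> 3 dvd (2 ^ m :: int)"
    using prime_dvd_power[of "3::int" 2 m] by auto
  then have tm: "multiplicity 3 (t m) = v" "t m \<noteq> 0"
  proof -
    have lead0: "int ((n + m) choose (3 * m)) \<noteq> 0"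
      using lead by (metis dvd_0_right)
    have e: "n - 2 * m = n mod 2" unfolding m_def by presburger
    show "t m \<noteq> 0" using c0 lead0 by (simp add: t_def)
    have "multiplicity 3 (t m) = multiplicity 3 (int ((n + m) choose (3 * m))) +
        multiplicity 3 (c m) + multiplicity 3 (2 ^ m :: int) + n mod 2"
      using c0 lead0 unfolding t_def e
      by (subst prime_elem_multiplicity_mult_distrib; simp)+
    then show "multiplicity 3 (t m) = v"
      using lead \<open>\<not> 3 dvd (2 ^ m :: int)\<close>
      by (simp add: c v_def not_dvd_imp_multiplicity_0)
  qed
  have tail: "3 ^ Suc v dvd t j" if "j < m" for j
  proof -
    have "s3 m \<le> s3 j + (m - j)"
      using s3_add_le[of j "m - j"] that by simp
    \<comment> \<open>Since \<open>n - 2 * j = 2 * (m - j) + n mod 2\<close>, one copy of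
      \<open>m - j\<close> covers the growth of the digit sum and the other, at least 1, gives
      strictness.\<close>
    then have "Suc v \<le> s3 j + (n - 2 * j)"
      using n that unfolding v_def by linarith
    then have "3 ^ Suc v dvd (3 ^ s3 j * 3 ^ (n - 2 * j) :: int)"
      unfolding power_add[symmetric] by (rule le_imp_power_dvd)
    also have "3 ^ s3 j dvd c j"
      using multiplicity_dvd[of 3 "c j"] by (simp add: c)
    then have "3 ^ s3 j * 3 ^ (n - 2 * j) dvd t j"
      unfolding t_def by (intro mult_dvd_mono dvd_mult2 dvd_mult) auto
    finally show ?thesis .
  qed
  then have rest: "3 ^ Suc v dvd (\<Sum>j<m. t j)"
    by (intro dvd_sum) auto
  have "multiplicity 3 (t m + (\<Sum>j<m. t j)) = v"
  proof (rule multiplicity_eqI)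
    show "3 ^ v dvd t m + (\<Sum>j<m. t j)"
      using multiplicity_dvd[of 3 "t m"] rest tm(1)
      by (metis dvd_add dvd_trans le_imp_power_dvd lessI less_imp_le)
    have "\<not> 3 ^ Suc v dvd t m"
      using tm by (subst power_dvd_iff_le_multiplicity) auto
    then show "\<not> 3 ^ Suc v dvd t m + (\<Sum>j<m. t j)"
      using rest by (simp only: dvd_add_left_iff not_False_eq_True)
  qed
  moreover have "(n - 1) div 2 = m" if "odd n"
    using that unfolding m_def by presburger
  ultimately show ?thesis
    unfolding sum v_def by (simp add: m_def[symmetric] odd_iff_mod_2_eq_one even_iff_mod_2_eq_zero)
qed

end
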